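(* Let $p$ be an odd prime and $a$ be a positive integer. Then $$ \sum_{k=0}^{p-1}(-1)^{(a-1)k}\binom{p-1}{k}^a\equiv 2^{a(p-1)}+\frac{a(a-1)(3a-4)}{48}\,p^3B_{p-3}\pmod{p^4}. $$
   Context: $B_n$ denotes the $n$-th Bernoulli number, defined by $\frac{t}{e^t-1}=\sum_{n=0}^{\infty}\frac{B_n}{n!}t^n$. Congruences between rational numbers are understood for rationals whose denominators are coprime to $p$: $x\equiv y\pmod{p^4}$ means $x-y=p^4 r$ with $r$ a rational number whose denominator is not divisible by $p$. *)

theory Defs
  imports "HOL-Computational_Algebra.Computational_Algebra" "HOL-Number_Theory.Number_Theory"
begin

definition bernoulli :: "nat \<Rightarrow> rat" where
  "bernoulli n = fact n * fps_nth (fps_X / (fps_exp 1 - 1)) n"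

definition rat_cong_pow :: "rat \<Rightarrow> rat \<Rightarrow> int \<Rightarrow> nat \<Rightarrow> bool" where
  "rat_cong_pow x y p k \<longleftrightarrow>
     (\<exists>r::rat. x - y = (of_int p) ^ k * r \<and> \<not> p dvd snd (quotient_of r))"

end

theory Submission
  imports Defs
begin

text \<open>
  Put \<open>x k = (-1)^k * (p-1 choose k) = (\<Prod>j\<le>k. 1 - p/j)\<close>, which is \<open>1\<close> modulo \<open>p\<close>. The sum in question is
  \<open>S a = (\<Sum>k. (-1)^k * x k ^ a)\<close>, and expanding \<open>x k = 1 + p * u k\<close> shows that modulo \<open>p^4\<close> it is a cubic
  polynomial in \<open>a\<close>; so is \<open>(2^(p-1))^a\<close>. It therefore suffices to know \<open>S\<close> at \<open>a = 0, 1, 2\<close> and \<open>a = -1\<close>: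
  \<open>S 0 = 1\<close> and \<open>S 1 = 2^(p-1)\<close>; \<open>S 2\<close> is \<open>\<plusminus>\<close> the central binomial coefficient; and
  \<open>S (-1) = (\<Sum>k. 1 / (p-1 choose k))\<close> has a closed form in terms of \<open>\<Sum>j. 2^j / j\<close>.
  With \<open>p = 2 * m + 1\<close>, both of these reduce by exact identities to the harmonic number \<open>H\<close> of index \<open>p - 1\<close>
  and to \<open>\<Sum>j\<le>m. 1 / j^3\<close>, where \<open>3 * H\<close> is itself \<open>p^2 / 2\<close> times the latter sum modulo \<open>p^3\<close>. Finally
  \<open>1 / j^3\<close> is \<open>j^(p-4)\<close> modulo \<open>p\<close>, and summing these powers up to \<open>(p - 1) / 2\<close> gives \<open>-2 * B\<close>, \<open>B\<close> the
  Bernoulli number of index \<open>p - 3\<close>, since \<open>(p + 1) / 2\<close> is \<open>1 / 2\<close> modulo \<open>p\<close>. The prime \<open>3\<close> is treated directly.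
\<close>

subsection \<open>Binomial identities\<close>

lemma of_nat_choose_2: "of_nat (a choose 2) = (of_nat a * (of_nat a - 1) / 2 :: 'a::field_char_0)"
  by (simp add: binomial_gbinomial gbinomial_prod_rev numeral_2_eq_2)

lemma of_nat_choose_3:
  "of_nat (a choose 3) = (of_nat a * (of_nat a - 1) * (of_nat a - 2) / 6 :: 'a::field_char_0)"
  by (simp add: binomial_gbinomial gbinomial_prod_rev numeral_3_eq_3 fact_numeral)

text \<open>Absorption writes both neighbours in row \<open>k + i + 1\<close> as multiples of
  \<open>k + i choose k\<close>, with denominators \<open>i + 1\<close> and \<open>k + 1\<close>;
  these add up to \<open>k + i + 2\<close>.\<close>

lemma inverse_binomial_add_inverse_binomial:
  "1 / of_nat (Suc (k + i) choose k) + 1 / of_nat (Suc (k + i) choose Suc k) =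
     of_nat (k + i + 2) / of_nat (k + i + 1) * (1 / of_nat (k + i choose k) :: 'a::field_char_0)"
proof -
  define c :: 'a where "c = of_nat (k + i choose k)"
  define N :: 'a where "N = of_nat (Suc (k + i))"
  have "of_nat (Suc (k + i) choose Suc k) * of_nat (Suc k) = N * c"
    by (metis Suc_times_binomial_eq of_nat_mult N_def c_def)
  then have 1: "of_nat (Suc (k + i) choose Suc k) = N * c / of_nat (Suc k)"
    by (metis nonzero_eq_divide_eq of_nat_neq_0)
  have "of_nat (Suc i) * of_nat (Suc (k + i) choose k) = N * c"
    unfolding N_def c_def of_nat_mult[symmetric] of_nat_eq_iff
    using binomial_absorb_comp[of "Suc (k + i)" k] by (simp add: Suc_diff_le)
  then have 2: "of_nat (Suc (k + i) choose k) = N * c / of_nat (Suc i)"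
    by (metis nonzero_eq_divide_eq of_nat_neq_0 mult.commute)
  have "of_nat (k + i + 1) = N" "of_nat (k + i + 2) = (of_nat (Suc i) + of_nat (Suc k) :: 'a)"
    unfolding N_def by simp_all
  moreover have "1 / of_nat (Suc (k + i) choose k) + 1 / of_nat (Suc (k + i) choose Suc k) =
     (of_nat (Suc i) + of_nat (Suc k)) / (N * c)"
    unfolding 1 2 by (simp add: add_divide_distrib del: of_nat_Suc)
  ultimately show ?thesis
    unfolding c_def[symmetric] by (simp only: times_divide_times_eq mult_1_right)
qed

lemma sum_inverse_binomial:
  "(\<Sum>k\<le>n. 1 / of_nat (n choose k) :: 'a::field_char_0) =
     of_nat (n + 1) / 2 ^ (n + 1) * (\<Sum>j=1..n+1. 2 ^ j / of_nat j)"
proof (induction n)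
  case (Suc n)
  let ?f = "\<lambda>n. \<Sum>k\<le>n. 1 / of_nat (n choose k) :: 'a"
  have step: "1 / of_nat (Suc n choose k) + 1 / of_nat (Suc n choose Suc k) =
      of_nat (n + 2) / of_nat (n + 1) * (1 / of_nat (n choose k) :: 'a)" if "k \<le> n" for k
    using inverse_binomial_add_inverse_binomial[of k "n - k", where 'a='a] that by simp
  \<comment> \<open>Detaching first the last and then the first term, and adding the two forms, puts
    neighbouring reciprocals side by side and gives a recurrence in \<open>n\<close>.\<close>
  have "?f (Suc n) = (\<Sum>k\<le>n. 1 / of_nat (Suc n choose k)) + 1"
    by simp
  moreover have "?f (Suc n) = 1 + (\<Sum>k\<le>n. 1 / of_nat (Suc n choose Suc k))"
    by (subst sum.atMost_Suc_shift) simp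
  ultimately have "2 * ?f (Suc n) =
      2 + (\<Sum>k\<le>n. 1 / of_nat (Suc n choose k) + 1 / of_nat (Suc n choose Suc k))"
    by (simp add: sum.distrib del: binomial_Suc_Suc)
  also have "\<dots> = 2 + of_nat (n + 2) / of_nat (n + 1) * ?f n"
    unfolding sum_distrib_left by (intro arg_cong2[of _ _ _ _ "(+)"] refl sum.cong step) auto
  also have "\<dots> = 2 + of_nat (n + 2) / 2 ^ (n + 1) * (\<Sum>j=1..n+1. 2 ^ j / of_nat j)"
    unfolding Suc.IH by (simp del: of_nat_Suc)
  finally have "2 * ?f (Suc n) = 2 * (1 + of_nat (n + 2) / 2 ^ (n + 2) * (\<Sum>j=1..n+1. 2 ^ j / of_nat j))"
    by (simp add: distrib_left del: of_nat_Suc sum.cl_ivl_Suc sum.atMost_Suc binomial_Suc_Suc)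
  then have "?f (Suc n) = 1 + of_nat (n + 2) / 2 ^ (n + 2) * (\<Sum>j=1..n+1. 2 ^ j / of_nat j)"
    by (simp only: mult_left_cancel[OF zero_neq_numeral[symmetric]])
  also have "\<dots> = of_nat (n + 2) / 2 ^ (n + 2) * (\<Sum>j=1..n+2. 2 ^ j / of_nat j)"
    by (simp add: distrib_left del: of_nat_Suc)
  finally show ?case by simp
qed simp

text \<open>By Pascal's rule the step to \<open>n + 1\<close> adds
  \<open>(n choose (k - 1)) / k\<close>, which by absorption is
  \<open>(n + 1 choose k) / (n + 1)\<close>; the row sum gives the new term on the right.\<close>

lemma sum_binomial_div:
  "(\<Sum>k=1..n. of_nat (n choose k) / of_nat k :: 'a::field_char_0) =
     (\<Sum>j=1..n. (2 ^ j - 1) / of_nat j)"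
proof (induction n)
  case (Suc n)
  have "(\<Sum>k=1..Suc n. of_nat (n choose (k - 1)) / of_nat k :: 'a) =
        (\<Sum>k=1..Suc n. of_nat (Suc n choose k)) / of_nat (Suc n)"
    unfolding sum_divide_distrib
  proof (intro sum.cong refl)
    fix k assume "k \<in> {1..Suc n}"
    then have "of_nat k * of_nat (Suc n choose k) = (of_nat (Suc n) * of_nat (n choose (k - 1)) :: 'a)"
      using times_binomial_minus1_eq[of k "Suc n"] unfolding of_nat_mult[symmetric] by simp
    with \<open>k \<in> _\<close> show "of_nat (n choose (k - 1)) / of_nat k = (of_nat (Suc n choose k) / of_nat (Suc n) :: 'a)"
      by (simp add: field_simps del: of_nat_Suc)
  qed
  also have "(\<Sum>k=1..Suc n. of_nat (Suc n choose k) :: 'a) = 2 ^ Suc n - 1"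
  proof -
    have "(\<Sum>k\<le>Suc n. of_nat (Suc n choose k) :: 'a) = 2 ^ Suc n"
      by (metis choose_row_sum of_nat_sum of_nat_power of_nat_numeral)
    then show ?thesis
      by (simp add: atMost_atLeast0 sum.atLeast_Suc_atMost del: sum.cl_ivl_Suc binomial_Suc_Suc power_Suc)
  qed
  finally have *: "(\<Sum>k=1..Suc n. of_nat (n choose (k - 1)) / of_nat k :: 'a) = (2 ^ Suc n - 1) / of_nat (Suc n)" .
  have "(\<Sum>k=1..Suc n. of_nat (Suc n choose k) / of_nat k :: 'a) =
        (\<Sum>k=1..Suc n. of_nat (n choose (k - 1)) / of_nat k + of_nat (n choose k) / of_nat k)"
  proof (intro sum.cong refl)
    fix k assume "k \<in> {1..Suc n}"
    then have "Suc n choose k = (n choose (k - 1)) + (n choose k)" by (cases k) auto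
    then show "of_nat (Suc n choose k) / of_nat k =
        (of_nat (n choose (k - 1)) / of_nat k + of_nat (n choose k) / of_nat k :: 'a)"
      by (simp add: add_divide_distrib)
  qed
  also have "\<dots> = (2 ^ Suc n - 1) / of_nat (Suc n) + (\<Sum>j=1..n. (2 ^ j - 1) / of_nat j)"
    unfolding sum.distrib * Suc.IH[symmetric] by simp
  finally show ?case by (simp del: of_nat_Suc power_Suc binomial_Suc_Suc)
qed simp

text \<open>Both sides are the coefficient of degree \<open>2 * m\<close> in
  \<open>(1 - X)^(2 * m) * (1 + X)^(2 * m) = (1 - X^2)^(2 * m)\<close>.\<close>

lemma alternating_sum_binomial_squared:
  "(\<Sum>k\<le>2 * m. (-1) ^ k * of_nat ((2 * m) choose k) ^ 2 :: 'a::idom) =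
     (-1) ^ m * of_nat ((2 * m) choose m)"
proof -
  let ?n = "2 * m"
  have "[:1, -1:] ^ ?n * [:1, 1:] ^ ?n = ([:1, -1:] * [:1, 1 :: 'a:]) ^ ?n"
    by (rule power_mult_distrib[symmetric])
  also have "[:1, -1:] * [:1, 1:] = 1 + Polynomial.monom (-1 :: 'a) 2"
    by (simp add: monom_altdef numeral_2_eq_2 one_pCons)
  finally have "Polynomial.coeff ([:1, -1:] ^ ?n * [:1, 1:] ^ ?n) ?n = Polynomial.coeff ((Polynomial.monom (-1 :: 'a) 2 + 1) ^ ?n) ?n"
    by (simp add: add.commute)
  also have "\<dots> = (\<Sum>k\<le>?n. of_nat (?n choose k) * (if k = m then (-1) ^ k else 0))"
    unfolding binomial_ring
    by (auto simp: coeff_sum monom_power of_nat_poly intro!: sum.cong)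
  also have "\<dots> = (-1) ^ m * of_nat (?n choose m)"
    by (simp add: if_distrib cong: if_cong)
  also have "Polynomial.coeff ([:1, -1:] ^ ?n * [:1, 1 :: 'a:] ^ ?n) ?n =
      (\<Sum>k\<le>?n. (-1) ^ k * of_nat (?n choose k) ^ 2)"
    by (auto simp: coeff_mult coeff_linear_power power2_eq_square binomial_symmetric[symmetric]
          coeff_linear_poly_power intro!: sum.cong)
  finally show ?thesis .
qed

text \<open>Consecutive binomials have ratio \<open>(n - j + 1) / j\<close>, the negative of
  \<open>1 - (n + 1) / j\<close>. For \<open>n + 1 = p\<close> every factor is 1 modulo
  \<open>p\<close>.\<close>

lemma minus_one_power_mult_binomial:
  "k \<le> n \<Longrightarrow> (-1) ^ k * of_nat (n choose k) = (\<Prod>j=1..k. 1 - of_nat (n + 1) / of_nat j :: 'a::field_char_0)"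
proof (induction k)
  case (Suc k)
  have "of_nat (Suc k) * of_nat (n choose Suc k) = (of_nat (n - k) * of_nat (n choose k) :: 'a)"
    by (metis binomial_absorb_comp binomial_absorption of_nat_mult)
  also have "of_nat (n - k) = (of_nat n - of_nat k :: 'a)" using Suc.prems by simp
  finally have *: "of_nat (Suc k) * of_nat (n choose Suc k) = (of_nat n - of_nat k) * (of_nat (n choose k) :: 'a)" .
  define y :: 'a where "y = 1 - of_nat (n + 1) / of_nat (Suc k)"
  have "of_nat (Suc k) * (- y) = (of_nat n - of_nat k :: 'a)"
    unfolding y_def by (simp add: right_diff_distrib del: of_nat_Suc) simp
  with * have "of_nat (Suc k) * of_nat (n choose Suc k) = of_nat (Suc k) * (- y * of_nat (n choose k))"
    by (metis mult.assoc)
  then have "of_nat (n choose Suc k) = - y * of_nat (n choose k)"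
    using of_nat_neq_0[of k, where 'a='a] by (metis mult_left_cancel)
  then have "(-1) ^ Suc k * of_nat (n choose Suc k) = ((-1) ^ k * of_nat (n choose k)) * y"
    by simp
  also have "(-1) ^ k * of_nat (n choose k) = (\<Prod>j=1..k. 1 - of_nat (n + 1) / of_nat j :: 'a)"
    using Suc by simp
  finally show ?case by (simp add: y_def)
qed simp

text \<open>The odd numbers below \<open>2 * m\<close> are the differences \<open>2 * m + 1 - 2 * j\<close>.\<close>

lemma central_binomial_eq_prod:
  "of_nat ((2 * m) choose m) =
     (-4) ^ m * (\<Prod>j=1..m. 1 - of_nat (2 * m + 1) / (2 * of_nat j) :: 'a::field_char_0)"
proof -
  have odd: "(\<Prod>j=1..m. 2 * of_nat j - 1) * 2 ^ m * fact m = (fact (2 * m) :: 'a)"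
  proof (induction m)
    case (Suc m)
    have "(\<Prod>j=1..Suc m. 2 * of_nat j - 1 :: 'a) * 2 ^ Suc m * fact (Suc m) =
       ((\<Prod>j=1..m. 2 * of_nat j - 1) * 2 ^ m * fact m) * ((2 * of_nat m + 1) * (2 * (of_nat m + 1)))"
      by (simp add: algebra_simps)
    also have "\<dots> = fact (2 * Suc m)"
      unfolding Suc.IH by (simp add: algebra_simps)
    finally show ?case .
  qed simp
  have "(\<Prod>j=1..m. 1 - of_nat (2 * m + 1) / (2 * of_nat j) :: 'a) =
        (\<Prod>j=1..m. (- 1 / 2) * (2 * of_nat (m + 1 - j) - 1) / of_nat j)"
    by (intro prod.cong refl) (auto simp: of_nat_diff field_simps)
  also have "\<dots> = (- 1) ^ m / 2 ^ m * (\<Prod>j=1..m. 2 * of_nat (m + 1 - j) - 1) / fact m"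
    unfolding prod_dividef prod.distrib by (simp add: fact_prod del: One_nat_def)
  also have "(\<Prod>j=1..m. 2 * of_nat (m + 1 - j) - 1 :: 'a) = (\<Prod>j=1..m. 2 * of_nat j - 1)"
    by (rule prod.reindex_bij_witness[of _ "\<lambda>j. m + 1 - j" "\<lambda>j. m + 1 - j"]) auto
  also have "(\<Prod>j=1..m. 2 * of_nat j - 1 :: 'a) = fact (2 * m) / (2 ^ m * fact m)"
    using odd by (simp add: field_simps)
  finally have "(-4) ^ m * (\<Prod>j=1..m. 1 - of_nat (2 * m + 1) / (2 * of_nat j) :: 'a) =
     ((-4) ^ m * (- 1) ^ m / (2 ^ m * 2 ^ m)) * (fact (2 * m) / (fact m * fact m))"
    by (simp add: field_simps)
  also have "(-4) ^ m * (- 1) ^ m / (2 ^ m * 2 ^ m) = (1 :: 'a)"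
    by (simp flip: power_mult_distrib)
  finally show ?thesis by (simp add: binomial_fact)
qed

section \<open>Pairing indices in sums over \<open>1..2 * m\<close>\<close>

lemma sum_pairs_reflect:
  fixes f :: "nat \<Rightarrow> 'a::comm_monoid_add"
  shows "(\<Sum>j=1..2 * m. f j) = (\<Sum>j=1..m. f j + f (2 * m + 1 - j))"
proof -
  have "{1..2 * m} = {1..m} \<union> {m+1..2 * m}" "{1..m} \<inter> {m+1..2 * m} = {}" by auto
  then have "(\<Sum>j=1..2 * m. f j) = (\<Sum>j=1..m. f j) + (\<Sum>j=m+1..2 * m. f j)"
    by (simp add: sum.union_disjoint)
  also have "(\<Sum>j=m+1..2 * m. f j) = (\<Sum>j=1..m. f (2 * m + 1 - j))"
    by (rule sum.reindex_bij_witness[of _ "\<lambda>j. 2 * m + 1 - j" "\<lambda>j. 2 * m + 1 - j"]) auto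
  finally show ?thesis by (simp add: sum.distrib)
qed

text \<open>Each even index \<open>2 * j\<close> is matched with the odd one that completes it to
  \<open>2 * m + 1\<close>, so that modulo this number the two are negatives of each other.\<close>

lemma sum_pairs_parity:
  fixes f :: "nat \<Rightarrow> 'a::comm_monoid_add"
  shows "(\<Sum>j=1..2 * m. f j) = (\<Sum>j=1..m. f (2 * j) + f (2 * m + 1 - 2 * j))"
proof -
  have "(\<Sum>j=1..2 * m. f j) = (\<Sum>j=1..m. f (2 * j)) + (\<Sum>j=1..m. f (2 * j - 1))"
    by (induction m) (simp_all add: add_ac)
  also have "(\<Sum>j=1..m. f (2 * j - 1)) = (\<Sum>j=1..m. f (2 * m + 1 - 2 * j))"
    by (rule sum.reindex_bij_witness[of _ "\<lambda>j. m + 1 - j" "\<lambda>j. m + 1 - j"]) (auto simp: algebra_simps)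
  finally show ?thesis by (simp add: sum.distrib)
qed

text \<open>A sharp form of Wolstenholme's theorem: in \<open>4 * H - H\<close> the first sum is
  paired by parity, the second by reflection. With \<open>x = j\<close> and
  \<open>z = N - 2 * j\<close>, the numerator of each difference is
  \<open>(2 * x + z)^2 = N^2\<close>.\<close>

lemma three_mult_harmonic:
  fixes m :: nat
  defines "N \<equiv> 2 * m + 1"
  shows "3 * (\<Sum>j=1..2 * m. 1 / of_nat j :: 'a::field_char_0) =
    of_nat N ^ 2 * (\<Sum>j=1..m. 1 / of_nat j * (1 / of_nat (N - j)) * (1 / of_nat (N - 2 * j)))"
proof -
  let ?H = "\<Sum>j=1..2 * m. 1 / of_nat j :: 'a"
  have "3 * ?H = 4 * ?H - ?H" by simp
  also have "\<dots> = 4 * (\<Sum>j=1..m. 1 / of_nat (2 * j) + 1 / of_nat (N - 2 * j))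
                 - (\<Sum>j=1..m. 1 / of_nat j + 1 / of_nat (N - j))"
    using sum_pairs_reflect[of "\<lambda>j. 1 / of_nat j :: 'a" m]
      sum_pairs_parity[of "\<lambda>j. 1 / of_nat j :: 'a" m] unfolding N_def by metis
  also have "\<dots> = (\<Sum>j=1..m. of_nat N ^ 2 * (1 / of_nat j * (1 / of_nat (N - j)) * (1 / of_nat (N - 2 * j))))"
    unfolding sum_distrib_left sum_subtractf[symmetric]
  proof (intro sum.cong refl)
    fix j assume j: "j \<in> {1..m}"
    define x y z :: 'a where "x = of_nat j" and "y = of_nat (N - j)" and "z = of_nat (N - 2 * j)"
    have "x \<noteq> 0" "y \<noteq> 0" "z \<noteq> 0" using j unfolding x_def y_def z_def N_def of_nat_eq_0_iff by auto
    moreover have "y = x + z" "of_nat N = 2 * x + z"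
      using j unfolding x_def y_def z_def N_def by (auto simp: of_nat_diff)
    moreover have "of_nat (2 * j) = 2 * x" by (simp add: x_def)
    ultimately show "4 * (1 / of_nat (2 * j) + 1 / of_nat (N - 2 * j)) - (1 / of_nat j + 1 / of_nat (N - j)) =
       of_nat N ^ 2 * (1 / of_nat j * (1 / of_nat (N - j)) * (1 / of_nat (N - 2 * j) :: 'a))"
      unfolding x_def[symmetric] y_def[symmetric] z_def[symmetric]
      by (simp add: divide_simps) (simp add: algebra_simps power2_eq_square)
  qed
  finally show ?thesis unfolding sum_distrib_left .
qed

text \<open>Folding \<open>k\<close> with \<open>n - k\<close> exposes a second factor \<open>n\<close>.\<close>

lemma sum_binomial_div_symmetric:
  "2 * (\<Sum>k=1..n-1. of_nat (n choose k) / of_nat k :: 'a::field_char_0) =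
     of_nat n ^ 2 * (\<Sum>k=1..n-1. of_nat ((n - 1) choose (k - 1)) * (1 / of_nat k) ^ 2 * (1 / of_nat (n - k)))"
proof -
  let ?f = "\<lambda>k. of_nat (n choose k) / of_nat k :: 'a"
  have "(\<Sum>k=1..n-1. ?f k) = (\<Sum>k=1..n-1. ?f (n - k))"
    by (rule sum.reindex_bij_witness[of _ "\<lambda>k. n - k" "\<lambda>k. n - k"]) auto
  then have "2 * (\<Sum>k=1..n-1. ?f k) = (\<Sum>k=1..n-1. ?f k + ?f (n - k))"
    by (simp add: sum.distrib)
  also have "\<dots> = (\<Sum>k=1..n-1. of_nat n ^ 2 * (of_nat ((n - 1) choose (k - 1)) * (1 / of_nat k) ^ 2 * (1 / of_nat (n - k))))"
  proof (intro sum.cong refl)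
    fix k assume k: "k \<in> {1..n-1}"
    define x y c :: 'a where "x = of_nat k" and "y = of_nat (n - k)" and "c = of_nat ((n - 1) choose (k - 1))"
    have nz: "x \<noteq> 0" "y \<noteq> 0" using k unfolding x_def y_def of_nat_eq_0_iff by auto
    have n: "of_nat n = x + y" using k unfolding x_def y_def by (auto simp: of_nat_diff)
    have "x * of_nat (n choose k) = of_nat n * c"
      unfolding x_def c_def of_nat_mult[symmetric] of_nat_eq_iff
      using times_binomial_minus1_eq[of k n] k by simp
    then have "x * of_nat (n choose k) = (x + y) * c" unfolding n .
    then have "of_nat (n choose k) = (x + y) * c / x" using nz by (simp add: field_simps)
    moreover have "n choose (n - k) = n choose k" using k by (auto intro: binomial_symmetric[symmetric])
    ultimately have "?f k + ?f (n - k) = (x + y) * c / x / x + (x + y) * c / x / y"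
      unfolding x_def[symmetric] y_def[symmetric] by simp
    also have "\<dots> = (x + y) ^ 2 * (c * (1 / x) ^ 2 * (1 / y))"
      using nz by (simp add: divide_simps) (simp add: algebra_simps power2_eq_square)
    finally show "?f k + ?f (n - k) = of_nat n ^ 2 * (of_nat ((n - 1) choose (k - 1)) * (1 / of_nat k) ^ 2 * (1 / of_nat (n - k)))"
      unfolding x_def y_def c_def n[unfolded x_def y_def] .
  qed
  finally show ?thesis unfolding sum_distrib_left .
qed

text \<open>Splitting \<open>2^j\<close> as \<open>1 + (2^j - 1)\<close> in
  \<open>\<Sum>j. 2^j / j\<close> yields the harmonic number and a sum of binomials over
  \<open>k\<close>. The latter contains \<open>-(2^n - 2) / n\<close>, which reduces the leading
  power of two to 1.\<close>

lemma sum_inverse_binomial_harmonic: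
  assumes "n > 0"
  shows "2 ^ (n - 1) * (\<Sum>k\<le>n-1. 1 / of_nat ((n - 1) choose k) :: 'a::field_char_0) =
    1 + of_nat n / 2 * (\<Sum>j=1..n-1. 1 / of_nat j) +
    of_nat n ^ 3 / 4 * (\<Sum>k=1..n-1. of_nat ((n - 1) choose (k - 1)) * (1 / of_nat k) ^ 2 * (1 / of_nat (n - k)))"
    (is "_ = 1 + _ * ?H + _ * ?W")
proof -
  obtain l where l: "n = Suc l" using assms gr0_implies_Suc by blast
  have n0: "of_nat n \<noteq> (0 :: 'a)" using assms by simp
  define R :: 'a where "R = (\<Sum>j=1..l. 2 ^ j / of_nat j)"
  have "2 ^ l * (\<Sum>k\<le>l. 1 / of_nat (l choose k) :: 'a) = of_nat n / 2 * (R + 2 ^ n / of_nat n)"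
    unfolding sum_inverse_binomial R_def l by (simp del: of_nat_Suc)
  also have "\<dots> = 2 ^ l + of_nat n / 2 * R" using n0 by (simp add: distrib_left l del: of_nat_Suc)
  also have "R = ?H + (\<Sum>k=1..l. of_nat (l choose k) / of_nat k)"
    unfolding sum_binomial_div R_def l by (simp add: diff_divide_distrib sum_subtractf)
  \<comment> \<open>Row \<open>n - 1\<close> is exchanged for row \<open>n\<close>, whose symmetry
    supplies the factor \<open>n^2\<close>.\<close>
  also have "(\<Sum>k=1..l. of_nat (l choose k) / of_nat k :: 'a) =
     (\<Sum>k=1..l. of_nat (n choose k) / of_nat k - of_nat (n choose k) / of_nat n)"
  proof (intro sum.cong refl)
    fix k assume k: "k \<in> {1..l}"
    have k0: "of_nat k \<noteq> (0 :: 'a)" using k by simp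
    have "of_nat (n - k) * of_nat (n choose k) = (of_nat n * of_nat (l choose k) :: 'a)"
      using binomial_absorb_comp[of n k] l unfolding of_nat_mult[symmetric] by simp
    moreover have "of_nat (n - k) = (of_nat n - of_nat k :: 'a)" using k l by (intro of_nat_diff) auto
    ultimately have "of_nat (l choose k) = (of_nat n - of_nat k) * of_nat (n choose k) / (of_nat n :: 'a)"
      using n0 by (simp add: field_simps)
    then show "of_nat (l choose k) / of_nat k = (of_nat (n choose k) / of_nat k - of_nat (n choose k) / of_nat n :: 'a)"
      using n0 k0 by (simp add: divide_simps) (simp add: algebra_simps)
  qed
  also have "\<dots> = of_nat n ^ 2 / 2 * ?W - (2 ^ n - 2) / of_nat n"
  proof -
    have "(\<Sum>k\<le>n. of_nat (n choose k) :: 'a) = 2 ^ n"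
      by (metis choose_row_sum of_nat_sum of_nat_power of_nat_numeral)
    then have "(\<Sum>k=1..l. of_nat (n choose k) :: 'a) = 2 ^ n - 2"
      by (simp add: l atMost_atLeast0 sum.atLeast_Suc_atMost algebra_simps del: binomial_Suc_Suc)
    moreover have "(\<Sum>k=1..l. of_nat (n choose k) / of_nat k :: 'a) = of_nat n ^ 2 / 2 * ?W"
    proof -
      have half: "s = N ^ 2 / 2 * w" if "2 * s = N ^ 2 * w" for s w N :: 'a
        using that by (simp add: field_simps)
      show ?thesis
        using half[OF sum_binomial_div_symmetric[of n, where 'a='a]] by (simp add: l)
    qed
    ultimately show ?thesis by (simp add: sum_subtractf flip: sum_divide_distrib)
  qed
  finally have "2 ^ l * (\<Sum>k\<le>l. 1 / of_nat (l choose k)) =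
     2 ^ l + of_nat n / 2 * (?H + (of_nat n ^ 2 / 2 * ?W - (2 ^ n - 2) / of_nat n))" .
  also have "\<dots> = 1 + of_nat n / 2 * ?H + of_nat n ^ 3 / 4 * ?W"
  proof -
    have "2 ^ l + of_nat n / 2 * (h + (of_nat n ^ 2 / 2 * w - (2 ^ n - 2) / of_nat n)) =
      1 + of_nat n / 2 * h + of_nat n ^ 3 / 4 * w" for h w :: 'a
    proof -
      have *: "c + N / 2 * (h + (N ^ 2 / 2 * w - t)) = 1 + N / 2 * h + N ^ 3 / 4 * w"
        if t: "N * t = 2 * c - 2" for N c t :: 'a
      proof -
        have 1: "N / 2 * (h + (N ^ 2 / 2 * w - t)) = N / 2 * h + N ^ 3 / 4 * w - N * t / 2"
          by (simp add: algebra_simps power2_eq_square power3_eq_cube)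
        have 2: "N * t / 2 = c - 1" unfolding t by (simp add: diff_divide_distrib)
        show ?thesis unfolding 1 2 by simp
      qed
      have "of_nat n * (z / of_nat n) = z" for z :: 'a using n0 by simp
      moreover have "2 ^ n = (2 * 2 ^ l :: 'a)" by (simp add: l)
      ultimately show ?thesis by (simp only: *)
    qed
    then show ?thesis .
  qed
  finally show ?thesis by (simp add: l)
qed

subsection \<open>Bernoulli numbers\<close>

text \<open>The quotient is genuine because \<open>fps_exp 1 - 1\<close> has order at most 1 and
  hence divides \<open>fps_X\<close>. The recurrence, the power sums and the value at
  \<open>1/2\<close> are derived from this equation alone.\<close>

lemma bernoulli_fps_mult:
  "(fps_X / (fps_exp 1 - 1)) * (fps_exp 1 - 1) = (fps_X :: 'a::field_char_0 fps)"
proof -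
  have "(fps_exp 1 - 1 :: 'a fps) $ 1 \<noteq> 0" by simp
  then have "subdegree (fps_exp 1 - 1 :: 'a fps) \<le> 1" by (rule subdegree_leI)
  moreover have "fps_exp 1 - 1 \<noteq> (0 :: 'a fps)" using \<open>_ $ 1 \<noteq> 0\<close> by fastforce
  ultimately have "fps_exp 1 - 1 dvd (fps_X :: 'a fps)" by (simp add: fps_dvd_iff)
  then show ?thesis by (rule dvd_div_mult_self)
qed

lemma fps_mult_exp_minus_1_nth:
  fixes f :: "'a::field_char_0 fps"
  shows "(f * (fps_exp c - 1)) $ Suc n = (\<Sum>i\<le>n. f $ i * c ^ (Suc n - i) / fact (Suc n - i))"
  by (simp add: fps_mult_nth atLeast0AtMost)

lemma fps_nth_bernoulli_recurrence:
  fixes f :: "'a::field_char_0 fps"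
  assumes "f * (fps_exp 1 - 1) = fps_X"
  shows "f $ n = (if n = 0 then 1 else 0) - (\<Sum>i<n. f $ i / fact (Suc n - i))"
proof -
  have "(\<Sum>i\<le>n. f $ i / fact (Suc n - i)) = (if n = 0 then 1 else 0)"
    using fps_mult_exp_minus_1_nth[of f 1 n] assms by simp
  then show ?thesis
    by (simp add: algebra_simps flip: lessThan_Suc_atMost)
qed

text \<open>Faulhaber's formula: the geometric series for \<open>fps_exp (of_nat N) - 1\<close> is
  multiplied by \<open>f\<close>, and coefficients at \<open>Suc n\<close> are compared.\<close>

lemma sum_powers_bernoulli:
  fixes f :: "'a::field_char_0 fps"
  assumes f: "f * (fps_exp 1 - 1) = fps_X"
  shows "(\<Sum>j<N. of_nat j ^ n) / fact n =
     (\<Sum>i\<le>n. f $ i * of_nat N ^ (Suc n - i) / fact (Suc n - i))"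
proof -
  have "f * (fps_exp (of_nat N) - 1) = fps_X * (\<Sum>j<N. fps_exp (of_nat j))"
  proof -
    have "fps_exp (of_nat N) - 1 = (fps_exp 1 - 1) * (\<Sum>j<N. fps_exp (of_nat j) :: 'a fps)"
      using power_diff_1_eq[of "fps_exp 1 :: 'a fps" N] by (simp add: fps_exp_power_mult)
    then show ?thesis by (metis f mult.assoc)
  qed
  then have "(f * (fps_exp (of_nat N) - 1)) $ Suc n = (\<Sum>j<N. fps_exp (of_nat j)) $ n"
    by simp
  then show ?thesis
    by (simp add: fps_mult_exp_minus_1_nth fps_sum_nth sum_divide_distrib)
qed

text \<open>The right-hand side is the value at \<open>1/2\<close> of the Bernoulli polynomial, with its constant term removed:
  it comes from \<open>t / (exp (t/2) + 1) = t / (exp (t/2) - 1) - 2 * t / (exp t - 1)\<close>.\<close>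

lemma bernoulli_half:
  fixes f :: "'a::field_char_0 fps"
  assumes f: "f * (fps_exp 1 - 1) = fps_X"
  shows "(\<Sum>i\<le>n. f $ i * (1/2) ^ (Suc n - i) / fact (Suc n - i)) = ((1/2) ^ n - 2) * f $ Suc n"
proof -
  define E where "E = fps_exp (1/2 :: 'a)"
  define g where "g = f oo (fps_const (1/2) * fps_X)"
  have E2: "fps_exp 1 = E * E" unfolding E_def by (simp flip: fps_exp_add_mult)
  have "E - 1 \<noteq> 0"
  proof
    assume "E - 1 = 0"
    then have "(E - 1) $ 1 = 0" by simp
    then show False by (simp add: E_def)
  qed
  have "g * (E - 1) = fps_const (1/2) * fps_X"
    using arg_cong[OF f, of "\<lambda>h. h oo (fps_const (1/2) * fps_X)"]
    by (simp add: fps_compose_mult_distrib fps_compose_sub_distrib g_def E_def)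
  then have "2 * (g * (E - 1)) = fps_X"
    by (simp add: fps_numeral_fps_const mult.assoc[symmetric])
  then have "2 * (g * (E - 1)) = f * (E * E - 1)" using f E2 by simp
  \<comment> \<open>Since \<open>E * E - 1 = (E - 1) * (E + 1)\<close>, the equation says
    \<open>f * (E + 1) = 2 * g\<close> up to the factor \<open>E - 1\<close>; subtracting
    \<open>2 * f\<close> turns \<open>E + 1\<close> into \<open>E - 1\<close>.\<close>
  then have "(E - 1) * (f * (E - 1)) = (E - 1) * (2 * g - 2 * f)"
    by (simp add: algebra_simps)
  then have "f * (E - 1) = 2 * g - 2 * f" using \<open>E - 1 \<noteq> 0\<close> by simp
  then have "(f * (E - 1)) $ Suc n = 2 * g $ Suc n - 2 * f $ Suc n"
    by (simp only: fps_numeral_fps_const fps_sub_nth fps_mult_left_const_nth)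
  moreover have "g $ Suc n = (1/2) ^ Suc n * f $ Suc n"
    unfolding g_def fps_compose_linear by simp
  ultimately have "(f * (E - 1)) $ Suc n = ((1/2) ^ n - 2) * f $ Suc n"
    by (simp add: left_diff_distrib)
  then show ?thesis
    unfolding E_def fps_mult_exp_minus_1_nth .
qed

lemma bernoulli_0: "bernoulli 0 = 1"
  using fps_nth_bernoulli_recurrence[OF bernoulli_fps_mult, where 'a=rat, of 0]
  by (simp add: bernoulli_def)

subsection \<open>Congruences between rational numbers modulo prime powers\<close>

locale prime_modulus =
  fixes p :: nat
  assumes prime_p: "prime p"
begin

text \<open>The localization of the integers at \<open>p\<close>, phrased by the reduced denominator
  to agree with \<open>rat_cong_pow\<close>.\<close>

definition pint :: "rat set" where
  "pint = {x. \<not> int p dvd snd (quotient_of x)}"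

lemma pint_iff: "x \<in> pint \<longleftrightarrow> (\<exists>a b. \<not> int p dvd b \<and> x = of_int a / of_int b)"
proof
  assume "x \<in> pint"
  then show "\<exists>a b. \<not> int p dvd b \<and> x = of_int a / of_int b"
    unfolding pint_def by (metis mem_Collect_eq prod.collapse quotient_of_div)
next
  assume "\<exists>a b. \<not> int p dvd b \<and> x = of_int a / of_int b"
  then obtain a b where b: "\<not> int p dvd b" and x: "x = of_int a / of_int b" by blast
  obtain n d where nd: "quotient_of x = (n, d)" by force
  have "d > 0" "coprime n d" "x = of_int n / of_int d"
    using nd quotient_of_denom_pos quotient_of_coprime quotient_of_div by auto
  moreover have "b \<noteq> 0" using b by auto
  ultimately have "of_int (n * b) = (of_int (a * d) :: rat)"
    using x by (simp add: field_simps)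
  then have "n * b = a * d" by (simp only: of_int_eq_iff)
  moreover have "\<not> int p dvd d"
  proof
    assume "int p dvd d"
    then have "int p dvd n * b" using \<open>n * b = a * d\<close> by simp
    then have "int p dvd n" using b prime_p by (simp add: prime_dvd_mult_iff)
    then show False using \<open>int p dvd d\<close> \<open>coprime n d\<close> prime_p
      by (metis coprime_common_divisor not_prime_unit prime_int_nat_transfer nat_int of_nat_0_le_iff)
  qed
  ultimately show "x \<in> pint" by (simp add: pint_def nd)
qed

lemma pint_of_int [simp, intro]: "of_int a \<in> pint"
  using not_prime_unit[of p] prime_p unfolding pint_iff by (intro exI[of _ a] exI[of _ 1]) auto

lemma pint_of_nat [simp, intro]: "of_nat a \<in> pint"
  using pint_of_int[of "int a"] by simp

lemma pint_numeral [simp, intro]: "0 \<in> pint" "1 \<in> pint" "numeral n \<in> pint"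
  using pint_of_int[of 0] pint_of_int[of 1] pint_of_int[of "numeral n"] by simp_all

lemma pint_inverse_of_nat: "\<not> p dvd j \<Longrightarrow> 1 / of_nat j \<in> pint"
  unfolding pint_iff by (intro exI[of _ 1] exI[of _ "int j"]) simp

lemma pint_mult [intro]: "x \<in> pint \<Longrightarrow> y \<in> pint \<Longrightarrow> x * y \<in> pint"
proof -
  assume "x \<in> pint" "y \<in> pint"
  then obtain a b c d where "\<not> int p dvd b" "x = of_int a / of_int b"
    "\<not> int p dvd d" "y = of_int c / of_int d" unfolding pint_iff by blast
  then show ?thesis unfolding pint_iff using prime_p
    by (intro exI[of _ "a * c"] exI[of _ "b * d"]) (simp add: prime_dvd_mult_iff)
qed

lemma pint_add [intro]: "x \<in> pint \<Longrightarrow> y \<in> pint \<Longrightarrow> x + y \<in> pint"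
proof -
  assume "x \<in> pint" "y \<in> pint"
  then obtain a b c d where *: "\<not> int p dvd b" "x = of_int a / of_int b"
    "\<not> int p dvd d" "y = of_int c / of_int d" unfolding pint_iff by blast
  then have "b \<noteq> 0" "d \<noteq> 0" by auto
  with * show ?thesis unfolding pint_iff using prime_p
    by (intro exI[of _ "a * d + c * b"] exI[of _ "b * d"]) (simp add: prime_dvd_mult_iff field_simps)
qed

lemma pint_uminus [intro]: "x \<in> pint \<Longrightarrow> - x \<in> pint"
  using pint_mult[of "- 1" x] pint_of_int[of "-1"] by simp

lemma pint_diff [intro]: "x \<in> pint \<Longrightarrow> y \<in> pint \<Longrightarrow> x - y \<in> pint"
  using pint_add[of x "- y"] pint_uminus by simp

lemma pint_power [intro]: "x \<in> pint \<Longrightarrow> x ^ n \<in> pint"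
  by (induction n) auto

lemma pint_sum [intro]: "(\<And>i. i \<in> A \<Longrightarrow> f i \<in> pint) \<Longrightarrow> sum f A \<in> pint"
  by (induction A rule: infinite_finite_induct) auto

lemma pint_prod [intro]: "(\<And>i. i \<in> A \<Longrightarrow> f i \<in> pint) \<Longrightarrow> prod f A \<in> pint"
  by (induction A rule: infinite_finite_induct) auto

lemma pint_divide_of_nat [intro]: "x \<in> pint \<Longrightarrow> \<not> p dvd j \<Longrightarrow> x / of_nat j \<in> pint"
  using pint_mult[OF _ pint_inverse_of_nat, of x j] by simp

definition cg :: "nat \<Rightarrow> rat \<Rightarrow> rat \<Rightarrow> bool" where
  "cg k x y \<longleftrightarrow> rat_cong_pow x y (int p) k"

lemma cg_iff: "cg k x y \<longleftrightarrow> (\<exists>r\<in>pint. x - y = of_nat p ^ k * r)"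
  by (auto simp: cg_def rat_cong_pow_def pint_def)

lemma cgI: "r \<in> pint \<Longrightarrow> x = y + of_nat p ^ k * r \<Longrightarrow> cg k x y"
  by (auto simp: cg_iff)

lemma cgE:
  assumes "cg k x y"
  obtains r where "r \<in> pint" "x = y + of_nat p ^ k * r"
  using assms by (metis cg_iff add.commute diff_add_cancel)

lemma cg_refl [simp, intro]: "cg k x x"
  by (rule cgI[of 0]) auto

lemma cg_sym: "cg k x y \<Longrightarrow> cg k y x"
  by (erule cgE, rule cgI[OF pint_uminus]) auto

lemma cg_trans [trans]: "cg k x y \<Longrightarrow> cg k y z \<Longrightarrow> cg k x z"
  by (elim cgE, rule cgI[OF pint_add]) (auto simp: algebra_simps)

lemma cg_add: "cg k x y \<Longrightarrow> cg k x' y' \<Longrightarrow> cg k (x + x') (y + y')"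
  by (elim cgE, rule cgI[OF pint_add]) (auto simp: algebra_simps)

lemma cg_uminus: "cg k x y \<Longrightarrow> cg k (- x) (- y)"
  by (elim cgE, rule cgI[OF pint_uminus]) (auto simp: algebra_simps)

lemma cg_diff: "cg k x y \<Longrightarrow> cg k x' y' \<Longrightarrow> cg k (x - x') (y - y')"
  using cg_add[OF _ cg_uminus] by fastforce

lemma cg_cmult: "cg k x y \<Longrightarrow> c \<in> pint \<Longrightarrow> cg k (c * x) (c * y)"
  unfolding cg_iff by (metis mult.left_commute pint_mult right_diff_distrib)

lemma cg_divide_of_nat: "cg k x y \<Longrightarrow> \<not> p dvd j \<Longrightarrow> cg k (x / of_nat j) (y / of_nat j)"
  using cg_cmult[OF _ pint_inverse_of_nat] by fastforce

lemma cg_mult: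
  assumes "cg k x y" "cg k x' y'" "x \<in> pint" "y' \<in> pint"
  shows "cg k (x * x') (y * y')"
proof -
  have "cg k (x * x') (x * y')" using assms by (intro cg_cmult)
  also have "cg k (x * y') (y * y')"
    using cg_cmult[OF assms(1,4)] by (simp add: mult.commute)
  finally show ?thesis .
qed

lemma cg_sum: "(\<And>i. i \<in> A \<Longrightarrow> cg k (f i) (g i)) \<Longrightarrow> cg k (sum f A) (sum g A)"
  by (induction A rule: infinite_finite_induct) (auto intro: cg_add)

lemma cg_prod:
  "(\<And>i. i \<in> A \<Longrightarrow> cg k (f i) (g i) \<and> f i \<in> pint \<and> g i \<in> pint) \<Longrightarrow> cg k (prod f A) (prod g A)"
  by (induction A rule: infinite_finite_induct) (auto intro: cg_mult)

lemma cg_power: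
  assumes "cg k x y" "x \<in> pint" "y \<in> pint"
  shows "cg k (x ^ n) (y ^ n)"
  by (induction n) (use assms in \<open>auto intro: cg_mult\<close>)

text \<open>A factor \<open>p^i\<close> buys \<open>i\<close> powers of precision: coefficients of
  \<open>p^3\<close> need to be known only modulo \<open>p\<close>.\<close>

lemma cg_p_power_mult: "cg k x y \<Longrightarrow> cg (i + k) (of_nat p ^ i * x) (of_nat p ^ i * y)"
  by (elim cgE, rule cgI) (auto simp: algebra_simps power_add)

text \<open>The binomial theorem, cut off after the cubic term because \<open>p^4\<close> divides
  \<open>y^4\<close>.\<close>

lemma power_expansion:
  assumes u: "u \<in> pint"
  defines "y \<equiv> of_nat p * u"
  shows "cg 4 ((1 + y) ^ a) (1 + of_nat a * y + of_nat (a choose 2) * y ^ 2 + of_nat (a choose 3) * y ^ 3)"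
proof (induction a)
  case (Suc a)
  have y: "y \<in> pint" using u by (auto simp: y_def)
  have "cg 4 ((1 + y) * (1 + y) ^ a)
    ((1 + y) * (1 + of_nat a * y + of_nat (a choose 2) * y ^ 2 + of_nat (a choose 3) * y ^ 3))"
    using Suc.IH y by (intro cg_cmult) auto
  also have "cg 4 \<dots> (1 + of_nat (Suc a) * y + of_nat (Suc a choose 2) * y ^ 2 + of_nat (Suc a choose 3) * y ^ 3)"
  proof (rule cgI)
    \<comment> \<open>By Pascal's rule, \<open>1 + y\<close> times the cubic for \<open>a\<close> is
      the cubic for \<open>a + 1\<close> plus the single leftover
      \<open>(a choose 3) * y^4\<close>.\<close>
    show "of_nat (a choose 3) * u ^ 4 \<in> pint" using u by blast
  qed (simp add: y_def eval_nat_numeral algebra_simps)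
  finally show ?case by simp
qed (simp add: eval_nat_numeral)

text \<open>The same expansion for exponent -1: a geometric series with exact remainder
  \<open>y^4 / (1 + y)\<close>.\<close>

lemma inverse_expansion:
  assumes u: "u \<in> pint" "1 / (1 + of_nat p * u) \<in> pint" "1 + of_nat p * u \<noteq> 0"
  defines "y \<equiv> of_nat p * u"
  shows "cg 4 (1 / (1 + y)) (1 - y + y ^ 2 - y ^ 3)"
proof (rule cgI)
  show "u ^ 4 * (1 / (1 + y)) \<in> pint" unfolding y_def by (intro pint_mult pint_power u)
  have "1 + y \<noteq> 0" using u by (simp add: y_def)
  moreover have "1 = (1 + y) * (1 - y + y ^ 2 - y ^ 3) + y ^ 4"
    by (simp add: algebra_simps eval_nat_numeral)
  ultimately have "1 / (1 + y) = 1 - y + y ^ 2 - y ^ 3 + y ^ 4 * (1 / (1 + y))"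
    by (simp add: field_simps)
  then show "1 / (1 + y) = 1 - y + y ^ 2 - y ^ 3 + of_nat p ^ 4 * (u ^ 4 * (1 / (1 + y)))"
    unfolding y_def power_mult_distrib[of _ _ 4] mult.assoc .
qed

text \<open>Any product of two correction terms contains \<open>p^4\<close>, so only the linear part
  survives.\<close>

lemma prod_one_plus_p_squared:
  assumes "finite A" "\<And>j. j \<in> A \<Longrightarrow> c j \<in> pint"
  shows "cg 4 (\<Prod>j\<in>A. 1 + of_nat p ^ 2 * c j) (1 + of_nat p ^ 2 * (\<Sum>j\<in>A. c j))"
  using assms
proof (induction A rule: finite_induct)
  case (insert i A)
  have c: "c i \<in> pint" "sum c A \<in> pint" using insert.prems by auto
  have "cg 4 ((1 + of_nat p ^ 2 * c i) * (\<Prod>j\<in>A. 1 + of_nat p ^ 2 * c j))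
             ((1 + of_nat p ^ 2 * c i) * (1 + of_nat p ^ 2 * sum c A))"
    using insert c by (intro cg_cmult) auto
  also have "cg 4 \<dots> (1 + of_nat p ^ 2 * (c i + sum c A))"
    by (rule cgI[OF pint_mult[OF c]]) (simp add: algebra_simps eval_nat_numeral)
  finally show ?case using insert.hyps by simp
qed simp

end

subsection \<open>Primes greater than three\<close>

text \<open>The bound makes 2 and 3 invertible modulo \<open>p\<close> and keeps the exponent
  \<open>p - 4\<close> positive.\<close>

locale prime_ge_5 = prime_modulus +
  fixes m :: nat
  assumes p_eq: "p = 2 * m + 1" and p_ge_5: "p \<ge> 5"
begin

definition cubes :: rat where "cubes = (\<Sum>j=1..m. (1 / of_nat j) ^ 3)"

lemma p_minus_1: "p - 1 = 2 * m"
  by (simp add: p_eq)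

lemma not_dvd: "0 < j \<Longrightarrow> j < p \<Longrightarrow> \<not> p dvd j"
  by (simp add: nat_dvd_not_less)

lemma pint_inverse [intro]: "0 < j \<Longrightarrow> j < p \<Longrightarrow> 1 / of_nat j \<in> pint"
  by (intro pint_inverse_of_nat not_dvd)

lemma pint_half: "1 / 2 \<in> pint"
  using pint_inverse[of 2] p_ge_5 by simp

lemma cg_of_nat: "[a = b] (mod p) \<Longrightarrow> cg 1 (of_nat a) (of_nat b)"
proof -
  assume "[a = b] (mod p)"
  then obtain c where "int a - int b = int p * c"
    by (metis cong_int_iff cong_iff_dvd_diff dvdE)
  then have "of_int (int a) - of_int (int b) = (of_int (int p * c) :: rat)"
    by (metis of_int_diff)
  then show ?thesis unfolding cg_iff by (intro bexI[of _ "of_int c"]) auto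
qed

lemma fermat: "0 < j \<Longrightarrow> j < p \<Longrightarrow> cg 1 (of_nat j ^ (p - 1)) 1"
  using cg_of_nat[OF fermat_theorem[OF prime_p not_dvd]] by simp

lemma cubes_pint: "cubes \<in> pint"
  unfolding cubes_def by (intro pint_sum pint_power pint_inverse) (use p_eq in auto)

text \<open>In the recurrence all denominators are factorials of numbers at most
  \<open>n + 1\<close>, hence prime to \<open>p\<close>.\<close>

lemma bernoulli_fps_pint:
  assumes f: "f * (fps_exp 1 - 1) = fps_X" and "n + 1 < p"
  shows "f $ n \<in> pint"
  using assms(2)
proof (induction n rule: less_induct)
  case (less n)
  have "f $ i / of_nat (fact (Suc n - i)) \<in> pint" if "i < n" for i
    using less that prime_p by (intro pint_divide_of_nat less.IH) (auto simp: prime_dvd_fact_iff)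
  then have "(\<Sum>i<n. f $ i / fact (Suc n - i)) \<in> pint"
    by (intro pint_sum) simp
  then show ?case
    by (subst fps_nth_bernoulli_recurrence[OF f]) auto
qed

lemma cubes_cong_bernoulli: "cg 1 cubes (- 2 * bernoulli (p - 3))"
proof -
  \<comment> \<open>By Fermat's theorem exponents count modulo \<open>p - 1\<close>, where
    \<open>-3\<close> becomes \<open>p - 4\<close>.\<close>
  define n where "n = p - 4"
  have n: "n > 0" "Suc n = p - 3" "p - 1 = n + 3" using p_ge_5 by (auto simp: n_def)
  define f :: "rat fps" where "f = fps_X / (fps_exp 1 - 1)"
  have f: "f * (fps_exp 1 - 1) = fps_X" unfolding f_def by (rule bernoulli_fps_mult)
  have B: "bernoulli (p - 3) = fact (Suc n) * f $ Suc n" unfolding n(2) bernoulli_def f_def ..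
  have B_pint: "bernoulli (p - 3) \<in> pint"
    unfolding B of_nat_fact[symmetric, where 'a=rat] using n by (intro pint_mult pint_of_nat bernoulli_fps_pint f) auto
  have "cg 1 cubes (\<Sum>j=1..m. of_nat j ^ n)"
    unfolding cubes_def
  proof (intro cg_sum)
    fix j assume j: "j \<in> {1..m}"
    have "cg 1 ((1 / of_nat j) ^ 3 * of_nat j ^ (p - 1)) ((1 / of_nat j) ^ 3 * 1)"
      using j p_eq by (intro cg_cmult pint_power pint_inverse fermat) auto
    moreover have "(1 / c) ^ 3 * c ^ (p - 1) = c ^ n" if "c \<noteq> 0" for c :: rat
      unfolding n(3) power_add power_one_over using that by simp
    ultimately show "cg 1 ((1 / of_nat j) ^ 3) (of_nat j ^ n)"
      using j by (simp add: cg_sym)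
  qed
  also have "(\<Sum>j=1..m. of_nat j ^ n) = (\<Sum>j<m+1. of_nat j ^ n :: rat)"
    using n(1) by (simp add: lessThan_Suc_atMost atMost_atLeast0 sum.atLeast_Suc_atMost zero_power)
  also have "\<dots> = fact n * (\<Sum>i\<le>n. f $ i * of_nat (m + 1) ^ (Suc n - i) / fact (Suc n - i))"
    unfolding sum_powers_bernoulli[OF f, symmetric] by simp
  also have "cg 1 \<dots> (fact n * (\<Sum>i\<le>n. f $ i * (1/2) ^ (Suc n - i) / fact (Suc n - i)))"
    unfolding of_nat_fact[symmetric, where 'a=rat]
  proof (intro cg_cmult cg_sum cg_divide_of_nat cg_power)
    \<comment> \<open>Here \<open>m + 1 = 1/2 + p * (1/2)\<close>; the substitution produces the sum
      evaluated by \<open>bernoulli_half\<close>.\<close>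
    show "cg 1 (of_nat (m + 1)) (1 / 2)"
      by (rule cgI[OF pint_half]) (simp add: p_eq add_divide_distrib)
    fix i assume "i \<in> {..n}"
    show "f $ i \<in> pint" using \<open>i \<in> _\<close> n by (intro bernoulli_fps_pint[OF f]) auto
    show "\<not> p dvd fact (Suc n - i)" using n prime_p by (auto simp: prime_dvd_fact_iff)
  qed (use pint_half pint_of_nat[of "fact n"] in auto)
  also have "fact n * (\<Sum>i\<le>n. f $ i * (1/2) ^ (Suc n - i) / fact (Suc n - i)) =
      ((1/2) ^ n - 2) * (bernoulli (p - 3) / of_nat (p - 3))"
  proof -
    have "fact n * f $ Suc n = bernoulli (p - 3) / of_nat (p - 3)"
      unfolding B unfolding n(2)[symmetric] by (simp del: of_nat_Suc)
    then show ?thesis unfolding bernoulli_half[OF f] by (metis mult.left_commute)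
  qed
  also have "cg 1 \<dots> ((8 - 2) * (bernoulli (p - 3) / of_nat (p - 3)))"
  proof (intro cg_mult cg_diff cg_refl)
    \<comment> \<open>The value 8 arises from
      \<open>(1/2)^(p - 4) * 2^(p - 1) = 2^3\<close>.\<close>
    have "cg 1 ((1/2) ^ n * of_nat 2 ^ (p - 1)) ((1/2) ^ n * 1)"
      using p_ge_5 by (intro cg_cmult fermat pint_power pint_half) auto
    also have "(1/2) ^ n * of_nat 2 ^ (p - 1) = (8 :: rat)"
      unfolding n(3) power_add power_one_over by simp
    finally show "cg 1 ((1/2) ^ n) 8" by (simp add: cg_sym)
    show "bernoulli (p - 3) / of_nat (p - 3) \<in> pint"
      using p_ge_5 by (intro pint_divide_of_nat B_pint not_dvd) auto
  qed (use pint_half in auto)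
  also have "cg 1 \<dots> (- 2 * bernoulli (p - 3))"
  proof (rule cgI)
    \<comment> \<open>The witness comes from \<open>6 = -2 * (p - 3) + 2 * p\<close>.\<close>
    show "2 * (bernoulli (p - 3) / of_nat (p - 3)) \<in> pint"
      using p_ge_5 by (intro pint_mult pint_divide_of_nat B_pint not_dvd) auto
    have "of_nat (p - 3) = (of_nat p - 3 :: rat)" "of_nat p - 3 \<noteq> (0 :: rat)"
      using p_ge_5 by (auto simp: of_nat_diff)
    then show "(8 - 2) * (bernoulli (p - 3) / of_nat (p - 3)) =
        - 2 * bernoulli (p - 3) + of_nat p ^ 1 * (2 * (bernoulli (p - 3) / of_nat (p - 3)))"
      by (simp add: field_simps)
  qed
  finally show ?thesis .
qed

lemma cg_inverse_diff: "0 < j \<Longrightarrow> j < p \<Longrightarrow> cg 1 (1 / of_nat (p - j)) (- (1 / of_nat j))"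
proof (rule cgI)
  assume j: "0 < j" "j < p"
  then show "1 / of_nat (p - j) * (1 / of_nat j) \<in> pint" by (intro pint_mult pint_inverse) auto
  have "of_nat (p - j) \<noteq> (0 :: rat)" "of_nat j \<noteq> (0 :: rat)" using j by auto
  moreover have "of_nat p = of_nat (p - j) + (of_nat j :: rat)" using j by (simp add: of_nat_diff)
  ultimately show "1 / of_nat (p - j) = - (1 / of_nat j) + of_nat p ^ 1 * (1 / of_nat (p - j) * (1 / of_nat j) :: rat)"
    by (simp add: field_simps del: of_nat_diff)
qed

section \<open>Wolstenholme's congruence for the harmonic number\<close>

definition H :: rat where "H = (\<Sum>j=1..p-1. 1 / of_nat j)"

text \<open>The exact identity already carries \<open>p^2\<close>, so its inner sum matters only
  modulo \<open>p\<close>. There \<open>p - j\<close> and \<open>p - 2 * j\<close> become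
  \<open>-j\<close> and \<open>-2 * j\<close>, and the two signs cancel.\<close>

lemma harmonic_cong: "cg 3 (3 * H) (of_nat p ^ 2 * (cubes / 2))"
proof -
  have "cg (2 + 1) (of_nat p ^ 2 * (\<Sum>j=1..m. 1 / of_nat j * (1 / of_nat (p - j)) * (1 / of_nat (p - 2 * j))))
     (of_nat p ^ 2 * (\<Sum>j=1..m. 1 / of_nat j * (- (1 / of_nat j)) * (- (1 / of_nat (2 * j)))))"
    by (intro cg_p_power_mult cg_sum cg_mult cg_refl cg_inverse_diff pint_mult pint_inverse pint_uminus)
       (use p_eq in auto)
  also have "(\<Sum>j=1..m. 1 / of_nat j * (- (1 / of_nat j)) * (- (1 / of_nat (2 * j)))) = cubes / 2"
    unfolding cubes_def sum_divide_distrib by (intro sum.cong refl) (simp add: power3_eq_cube)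
  also have "of_nat p ^ 2 * (\<Sum>j=1..m. 1 / of_nat j * (1 / of_nat (p - j)) * (1 / of_nat (p - 2 * j))) = 3 * H"
    unfolding H_def three_mult_harmonic[of m, folded p_eq, symmetric] by (simp add: p_eq)
  finally show ?thesis by simp
qed

section \<open>Signed binomial coefficients of row \<open>p - 1\<close>\<close>

definition x :: "nat \<Rightarrow> rat" where "x k = (-1) ^ k * of_nat ((p - 1) choose k)"

lemma x_eq: "k < p \<Longrightarrow> x k = (\<Prod>j=1..k. 1 - of_nat p / of_nat j)"
  unfolding x_def using minus_one_power_mult_binomial[of k "p - 1", where 'a=rat] p_ge_5 by simp

lemma x_cong: "k < p \<Longrightarrow> cg 1 (x k) 1"
proof -
  assume k: "k < p"
  have "cg 1 (\<Prod>j=1..k. 1 - of_nat p / of_nat j) (\<Prod>j=1..k. 1)"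
  proof (intro cg_prod conjI)
    fix j assume j: "j \<in> {1..k}"
    then have "- (1 / of_nat j) \<in> pint" using k by (intro pint_uminus pint_inverse) auto
    then show "cg 1 (1 - of_nat p / of_nat j) 1" by (rule cgI) simp
    show "1 - of_nat p / of_nat j \<in> pint"
      using j k by (intro pint_diff pint_divide_of_nat not_dvd) auto
  qed auto
  then show ?thesis by (simp add: x_eq k)
qed

text \<open>Modulo \<open>p\<close> the binomial is \<open>(-1)^(k - 1)\<close> and
  \<open>1 / (p - k)\<close> is \<open>-1 / k\<close>, which leaves the alternating sum of inverse
  cubes. In the parity pairing both members contribute \<open>1 / (2 * j)^3\<close>.\<close>

lemma W_cong:
  "cg 1 (\<Sum>k=1..p-1. of_nat ((p - 1) choose (k - 1)) * (1 / of_nat k) ^ 2 * (1 / of_nat (p - k))) (cubes / 4)"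
proof -
  have c: "cg 1 (of_nat ((p - 1) choose k)) ((-1) ^ k)" if "k < p" for k
  proof -
    have "cg 1 ((-1) ^ k * x k) ((-1) ^ k * 1)"
      using pint_of_int[of "(-1) ^ k"] that by (intro cg_cmult x_cong) auto
    then show ?thesis by (simp add: x_def mult.assoc[symmetric] flip: power_add)
  qed
  have "cg 1 (\<Sum>k=1..p-1. of_nat ((p - 1) choose (k - 1)) * (1 / of_nat k) ^ 2 * (1 / of_nat (p - k)))
     (\<Sum>k=1..p-1. (-1) ^ (k - 1) * (1 / of_nat k) ^ 2 * (- (1 / of_nat k)))"
    by (intro cg_sum cg_mult c cg_refl cg_inverse_diff pint_mult pint_power pint_inverse pint_of_nat pint_uminus) auto
  also have "(\<Sum>k=1..p-1. (-1) ^ (k - 1) * (1 / of_nat k) ^ 2 * (- (1 / of_nat k))) =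
     (\<Sum>k=1..2*m. (-1) ^ k * (1 / of_nat k) ^ 3 :: rat)"
  proof (rule sum.cong)
    show "{1..p-1} = {1..2*m}" by (simp add: p_eq)
    fix k assume "k \<in> {1..2*m}"
    then obtain l where "k = Suc l" by (cases k) auto
    then show "(-1) ^ (k - 1) * (1 / of_nat k) ^ 2 * (- (1 / of_nat k)) = (-1) ^ k * (1 / of_nat k :: rat) ^ 3"
      by (simp add: power3_eq_cube power2_eq_square del: of_nat_Suc)
  qed
  also have "\<dots> = (\<Sum>j=1..m. (1 / of_nat (2 * j)) ^ 3 + (- ((1 / of_nat (p - 2 * j)) ^ 3)))"
    unfolding sum_pairs_parity p_eq[symmetric]
  proof (intro sum.cong refl arg_cong2[of _ _ _ _ "(+)"])
    fix j assume "j \<in> {1..m}"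
    then have "odd (p - 2 * j)" by (auto simp: p_eq)
    then show "(-1) ^ (p - 2 * j) * (1 / of_nat (p - 2 * j)) ^ 3 = - ((1 / of_nat (p - 2 * j) :: rat) ^ 3)"
      by simp
  qed simp
  also have "cg 1 \<dots> (\<Sum>j=1..m. (1 / of_nat (2 * j)) ^ 3 + (- ((- (1 / of_nat (2 * j))) ^ 3)))"
    by (intro cg_sum cg_add cg_refl cg_uminus cg_power cg_inverse_diff pint_inverse pint_uminus)
       (use p_eq in auto)
  also have "\<dots> = cubes / 4"
    unfolding cubes_def sum_divide_distrib
    by (intro sum.cong refl) (simp add: power3_eq_cube field_simps)
  finally show ?thesis .
qed

lemma x_eq_one_plus:
  assumes "k < p"
  obtains u where "u \<in> pint" "x k = 1 + of_nat p * u"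
  using cgE[OF x_cong[OF assms]] by (metis power_one_right)

lemma pint_inverse_x:
  assumes "k < p"
  shows "1 / x k \<in> pint" "x k \<noteq> 0"
proof -
  have "((p - 1) choose k) dvd fact (p - 1)"
    using binomial_fact_lemma[of k "p - 1"] assms by (metis dvd_triv_right Suc_pred' less_Suc_eq_le prime_gt_0_nat prime_p)
  then have "\<not> p dvd ((p - 1) choose k)"
    using prime_p p_ge_5 by (metis dvd_trans prime_dvd_fact_iff diff_less less_le_trans zero_less_numeral zero_less_one not_le)
  then have "(-1) ^ k / of_nat ((p - 1) choose k) \<in> pint"
    using pint_of_int[of "(-1) ^ k"] by (intro pint_divide_of_nat) auto
  moreover have "1 / x k = (-1) ^ k / of_nat ((p - 1) choose k)"
    by (cases "even k") (simp_all add: x_def)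
  ultimately show "1 / x k \<in> pint" by simp
  show "x k \<noteq> 0" using assms by (simp add: x_def)
qed

section \<open>The sums for the exponents -1 and 2\<close>

definition Q :: rat where "Q = 2 ^ (p - 1)"

lemma pint_inverse_Q: "Q \<in> pint" "1 / Q \<in> pint" "Q \<noteq> 0"
  using pint_power[OF pint_half, of "p - 1"] by (auto simp: Q_def power_one_over)

lemma Q_cong: "cg 1 Q 1"
  using fermat[of 2] p_ge_5 by (simp add: Q_def)

lemma inverse_Q_cong: "cg 1 (1 / Q) 1"
  using cg_cmult[OF cg_sym[OF Q_cong] pint_inverse_Q(2)] pint_inverse_Q(3) by simp

lemma cg_p_cubed:
  assumes "cg 1 c 1" "y \<in> pint"
  shows "cg 4 (c * (of_nat p ^ 3 * y)) (of_nat p ^ 3 * y)"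
  using cg_p_power_mult[OF cg_cmult[OF assms], of 3] by (simp add: mult_ac)

lemma p_harmonic_cong: "cg 4 (of_nat p * H) (of_nat p ^ 3 * (cubes / 6))"
proof -
  have "cg (1 + 3) (of_nat p ^ 1 * (3 * H / of_nat 3)) (of_nat p ^ 1 * (of_nat p ^ 2 * (cubes / 2) / of_nat 3))"
    using p_ge_5 by (intro cg_p_power_mult cg_divide_of_nat harmonic_cong not_dvd) auto
  then show ?thesis by (simp add: power3_eq_cube power2_eq_square mult_ac)
qed

lemma pint_divide_2_power: "y \<in> pint \<Longrightarrow> y / 2 ^ n \<in> pint"
  using pint_mult[OF _ pint_power[OF pint_half, of n], of y] by (simp add: power_one_over)

lemma cg_divide_2_power: "cg k y z \<Longrightarrow> cg k (y / 2 ^ n) (z / 2 ^ n)"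
  using cg_cmult[OF _ pint_power[OF pint_half, of n], of k y z] by (simp add: power_one_over)

lemma not_dvd_2_3_power: "\<not> p dvd 2 ^ i * 3 ^ j"
proof
  assume "p dvd 2 ^ i * 3 ^ j"
  then have "p dvd 2 \<or> p dvd 3" using prime_p by (auto simp: prime_dvd_mult_iff dest: prime_dvd_power)
  then show False using p_ge_5 by (auto dest!: dvd_imp_le)
qed

lemma sum_inverse_x:
  "cg 4 (\<Sum>k\<le>p-1. (-1) ^ k * (1 / x k)) (1 / Q + of_nat p ^ 3 * (7 / 48 * cubes))"
    (is "cg 4 ?S _")
proof -
  let ?P = "of_nat p :: rat"
  define W where "W = (\<Sum>k=1..p-1. of_nat ((p - 1) choose (k - 1)) * (1 / of_nat k) ^ 2 * (1 / of_nat (p - k)) :: rat)"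
  have "?S = (\<Sum>k\<le>p-1. 1 / of_nat ((p - 1) choose k))"
    by (intro sum.cong refl) (simp add: x_def)
  then have "Q * ?S = 1 + ?P * H / 2 + ?P ^ 3 * W / 4"
    using sum_inverse_binomial_harmonic[of p, where 'a=rat] p_ge_5 unfolding Q_def H_def W_def by simp
  also have "cg 4 \<dots> (1 + ?P ^ 3 * (cubes / 6) / 2 + ?P ^ 3 * (cubes / 4) / 4)"
    using cg_divide_2_power[OF p_harmonic_cong, of 1]
      cg_divide_2_power[OF cg_p_power_mult[OF W_cong[folded W_def], of 3], of 2]
    by (intro cg_add cg_refl) auto
  \<comment> \<open>The harmonic number contributes \<open>1/12\<close> and \<open>W\<close>
    contributes \<open>1/16\<close>.\<close>
  also have "\<dots> = 1 + ?P ^ 3 * (7 / 48 * cubes)" by simp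
  finally have "cg 4 (1 / Q * (Q * ?S)) (1 / Q * (1 + ?P ^ 3 * (7 / 48 * cubes)))"
    by (intro cg_cmult pint_inverse_Q)
  then have "cg 4 ?S (1 / Q + 1 / Q * (?P ^ 3 * (7 / 48 * cubes)))"
    using pint_inverse_Q(3) by (simp add: distrib_left)
  also have "cg 4 \<dots> (1 / Q + ?P ^ 3 * (7 / 48 * cubes))"
  proof (intro cg_add cg_refl cg_p_cubed inverse_Q_cong)
    have "7 * (cubes / of_nat (2 ^ 4 * 3 ^ 1)) \<in> pint"
      by (intro pint_mult pint_divide_of_nat cubes_pint pint_numeral not_dvd_2_3_power)
    then show "7 / 48 * cubes \<in> pint" by simp
  qed
  finally show ?thesis .
qed

text \<open>The sum is the signed central binomial \<open>x m\<close>, which equals both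
  \<open>\<Prod>j. 1 - p / j\<close> and \<open>Q * h\<close>. Squaring the second form and
  cancelling the first leaves \<open>Q^2\<close> times factors that are 1 modulo
  \<open>p^2\<close>.\<close>

lemma sum_x_squared:
  "cg 4 (\<Sum>k\<le>p-1. (-1) ^ k * x k ^ 2) (Q ^ 2 - of_nat p ^ 3 * (cubes / 24))"
proof -
  let ?P = "of_nat p :: rat"
  \<comment> \<open>Chosen so that
    \<open>(1 - p / (2 * j))^2 = (1 - p / j) * (1 + p^2 * c j)\<close> holds exactly.\<close>
  define c where "c j = - (1 / of_nat j * (1 / of_nat (p - j)) / 2 ^ 2 :: rat)" for j
  define h where "h = (\<Prod>j=1..m. 1 - ?P / (2 * of_nat j))"
  have "m < p" by (simp add: p_eq)
  have "(\<Sum>k\<le>p-1. (-1) ^ k * x k ^ 2) = x m"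
    using alternating_sum_binomial_squared[of m, where 'a=rat]
    unfolding x_def p_minus_1 by (simp add: power_mult_distrib flip: power_mult)
  also have "x m = Q ^ 2 * (\<Prod>j=1..m. 1 + ?P ^ 2 * c j)"
  proof -
    have "(-1) ^ m * (-4) ^ m = (Q :: rat)"
      unfolding power_mult_distrib[symmetric] Q_def p_minus_1 power_mult by simp
    then have xh: "x m = Q * h"
      unfolding x_def p_minus_1 central_binomial_eq_prod h_def p_eq[symmetric] by (simp flip: mult.assoc)
    have "h ^ 2 = (\<Prod>j=1..m. (1 - ?P / of_nat j) * (1 + ?P ^ 2 * c j))"
      unfolding h_def prod_power_distrib
    proof (intro prod.cong refl)
      fix j assume j: "j \<in> {1..m}"
      define y z :: rat where "y = of_nat j" and "z = of_nat (p - j)"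
      have "y \<noteq> 0" "z \<noteq> 0" using j p_eq unfolding y_def z_def of_nat_eq_0_iff by auto
      moreover have P: "?P = y + z" using j p_eq unfolding y_def z_def by (simp add: of_nat_diff)
      ultimately have "(1 - (y + z) / (2 * y)) ^ 2 = (1 - (y + z) / y) * (1 + (y + z) ^ 2 * - (1 / y * (1 / z) / 2 ^ 2))"
        by (simp add: divide_simps) (simp add: algebra_simps power2_eq_square)
      then show "(1 - ?P / (2 * of_nat j)) ^ 2 = (1 - ?P / of_nat j) * (1 + ?P ^ 2 * c j)"
        unfolding c_def P y_def z_def .
    qed
    also have "\<dots> = x m * (\<Prod>j=1..m. 1 + ?P ^ 2 * c j)"
      unfolding prod.distrib x_eq[OF \<open>m < p\<close>] ..
    finally have "x m * x m = x m * (Q ^ 2 * (\<Prod>j=1..m. 1 + ?P ^ 2 * c j))"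
      unfolding power2_eq_square using xh by (metis mult.assoc mult.commute)
    then show ?thesis using pint_inverse_x(2)[OF \<open>m < p\<close>] by (metis mult_left_cancel)
  qed
  also have "cg 4 \<dots> (Q ^ 2 * (1 + ?P ^ 2 * (\<Sum>j=1..m. c j)))"
    unfolding c_def using p_eq
    by (intro cg_cmult prod_one_plus_p_squared pint_uminus pint_divide_2_power pint_mult pint_inverse
        pint_power pint_inverse_Q) auto
  \<comment> \<open>Reflection pairs satisfy \<open>1 / j + 1 / (p - j) = p / (j * (p - j))\<close>,
    so the linear term is a multiple of \<open>p * H\<close>, which is known modulo
    \<open>p^4\<close>.\<close>
  also have "?P ^ 2 * (\<Sum>j=1..m. c j) = - (?P * H / 2 ^ 2)"
  proof -
    have "H = (\<Sum>j=1..m. 1 / of_nat j + 1 / of_nat (p - j))"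
      unfolding H_def p_minus_1 sum_pairs_reflect p_eq[symmetric] ..
    also have "\<dots> = (\<Sum>j=1..m. - (2 ^ 2 * (?P * c j)))"
    proof (intro sum.cong refl)
      fix j assume j: "j \<in> {1..m}"
      define y z :: rat where "y = of_nat j" and "z = of_nat (p - j)"
      have "y \<noteq> 0" "z \<noteq> 0" using j p_eq unfolding y_def z_def of_nat_eq_0_iff by auto
      moreover have P: "?P = y + z" using j p_eq unfolding y_def z_def by (simp add: of_nat_diff)
      ultimately have "1 / y + 1 / z = - (2 ^ 2 * ((y + z) * - (1 / y * (1 / z) / 2 ^ 2)))"
        by (simp add: divide_simps)
      then show "1 / of_nat j + 1 / of_nat (p - j) = - (2 ^ 2 * (?P * c j))"
        unfolding c_def P y_def z_def .
    qed
    also have "\<dots> = - (2 ^ 2 * (?P * (\<Sum>j=1..m. c j)))"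
      unfolding sum_negf sum_distrib_left ..
    finally show ?thesis by (simp add: power2_eq_square)
  qed
  also have "Q ^ 2 * (1 + - (?P * H / 2 ^ 2)) = Q ^ 2 - Q ^ 2 * (?P * H / 2 ^ 2)"
    by (simp add: algebra_simps)
  also have "cg 4 \<dots> (Q ^ 2 - Q ^ 2 * (?P ^ 3 * (cubes / 6) / 2 ^ 2))"
    by (intro cg_diff cg_refl cg_cmult cg_divide_2_power p_harmonic_cong pint_power pint_inverse_Q)
  also have "?P ^ 3 * (cubes / 6) / 2 ^ 2 = ?P ^ 3 * (cubes / 24)" by simp
  also have "cg 4 (Q ^ 2 - Q ^ 2 * (?P ^ 3 * (cubes / 24))) (Q ^ 2 - ?P ^ 3 * (cubes / 24))"
  proof (intro cg_diff cg_refl cg_p_cubed)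
    show "cg 1 (Q ^ 2) 1" using cg_power[OF Q_cong, of 2] pint_inverse_Q by simp
    show "cubes / 24 \<in> pint"
      using pint_divide_of_nat[OF cubes_pint not_dvd_2_3_power[of 3 1]] by simp
  qed
  finally show ?thesis .
qed

section \<open>Alternating moments of \<open>x k - 1\<close>, and general exponents\<close>

definition T :: "nat \<Rightarrow> rat" where "T i = (\<Sum>k\<le>p-1. (-1) ^ k * (x k - 1) ^ i)"

lemma T_0: "T 0 = 1"
proof -
  have "(\<Sum>k\<le>2 * l. (-1) ^ k) = (1 :: rat)" for l
    by (induction l) simp_all
  then show ?thesis by (simp only: T_def p_minus_1 power_0 mult_1_right)
qed

lemma T_1: "T 1 = Q - 1"
proof -
  have "(\<Sum>k\<le>p-1. (-1) ^ k * x k) = (\<Sum>k\<le>p-1. of_nat ((p - 1) choose k))"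
    by (intro sum.cong refl) (simp add: x_def flip: mult.assoc power_mult_distrib)
  also have "\<dots> = Q" unfolding Q_def by (metis choose_row_sum of_nat_sum of_nat_power of_nat_numeral)
  finally show ?thesis using T_0 by (simp add: T_def right_diff_distrib sum_subtractf)
qed

lemma T_2: "T 2 = (\<Sum>k\<le>p-1. (-1) ^ k * x k ^ 2) - 2 * T 1 - T 0"
  unfolding T_def sum_distrib_left sum_subtractf[symmetric]
  by (intro sum.cong refl) (simp add: power2_eq_square algebra_simps)

text \<open>\<open>T 0\<close> and \<open>T 1\<close> are exactly the powers of
  \<open>Q - 1\<close>; the deviation in \<open>T 2\<close> is that of the sum of squares.\<close>

lemma T_2_cong: "cg 4 (T 2) ((Q - 1) ^ 2 - of_nat p ^ 3 * (cubes / 24))"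
proof -
  have "cg 4 (T 2) (Q ^ 2 - of_nat p ^ 3 * (cubes / 24) - 2 * T 1 - T 0)"
    unfolding T_2 by (intro cg_diff cg_refl sum_x_squared)
  then show ?thesis
    unfolding T_0 T_1 by (simp add: power2_eq_square algebra_simps)
qed

text \<open>Expanding \<open>1 / x k\<close> yields \<open>T 0 - T 1 + T 2 - T 3\<close>, and
  \<open>1 / Q\<close> yields the same combination of powers of \<open>Q - 1\<close>. Solving for
  \<open>T 3\<close> collects the deviation \<open>1/24 + 7/48 = 3/16\<close>.\<close>

lemma T_3_cong: "cg 4 (T 3) ((Q - 1) ^ 3 - of_nat p ^ 3 * (3 / 16 * cubes))"
proof -
  let ?P = "of_nat p :: rat" and ?S = "\<Sum>k\<le>p-1. (-1) ^ k * (1 / x k)"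
  have inverse_x: "cg 4 (1 / x k) (1 - (x k - 1) + (x k - 1) ^ 2 - (x k - 1) ^ 3)" if "k < p" for k
  proof -
    obtain u where "u \<in> pint" "x k = 1 + ?P * u" using x_eq_one_plus[OF \<open>k < p\<close>] by blast
    with inverse_expansion[of u] pint_inverse_x[OF that] show ?thesis by simp
  qed
  have "cg 4 ?S (\<Sum>k\<le>p-1. (-1) ^ k * (1 - (x k - 1) + (x k - 1) ^ 2 - (x k - 1) ^ 3))"
    using p_ge_5 pint_of_int[of "(-1) ^ _"] by (intro cg_sum cg_cmult inverse_x) auto
  also have "\<dots> = T 0 - T 1 + T 2 - T 3"
    unfolding T_def sum_subtractf[symmetric] sum.distrib[symmetric]
    by (intro sum.cong refl) (simp add: algebra_simps)
  finally have S: "cg 4 ?S (T 0 - T 1 + T 2 - T 3)" .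
  have inverse_Q: "cg 4 (1 / Q) (1 - (Q - 1) + (Q - 1) ^ 2 - (Q - 1) ^ 3)"
  proof -
    obtain u where "u \<in> pint" "Q = 1 + ?P * u"
      using cgE[OF Q_cong] by (metis power_one_right)
    with inverse_expansion[of u] pint_inverse_Q show ?thesis by simp
  qed
  have "T 3 = T 0 - T 1 + T 2 - (T 0 - T 1 + T 2 - T 3)" by simp
  also have "cg 4 \<dots> (T 0 - T 1 + ((Q - 1) ^ 2 - ?P ^ 3 * (cubes / 24)) -
      (1 - (Q - 1) + (Q - 1) ^ 2 - (Q - 1) ^ 3 + ?P ^ 3 * (7 / 48 * cubes)))"
    by (intro cg_diff[OF cg_add[OF cg_refl T_2_cong]] cg_trans[OF cg_sym[OF S]]
        cg_trans[OF sum_inverse_x] cg_add[OF inverse_Q cg_refl])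
  also have "\<dots> = (Q - 1) ^ 3 - ?P ^ 3 * (3 / 16 * cubes)"
    unfolding T_0 T_1 by simp
  finally show ?thesis .
qed

text \<open>After the cubic expansion each moment is a power of \<open>Q - 1\<close> minus a
  multiple of \<open>p^3 * cubes\<close>. The powers reassemble to \<open>Q^a\<close>; the multiples
  give the Bernoulli term.\<close>

lemma sum_x_power:
  "cg 4 (\<Sum>k\<le>p-1. (-1) ^ k * x k ^ a)
     (Q ^ a + of_nat a * (of_nat a - 1) * (3 * of_nat a - 4) / 48 * of_nat p ^ 3 * bernoulli (p - 3))"
proof -
  let ?P = "of_nat p :: rat" and ?C = "\<lambda>i. of_nat (a choose i) :: rat"
  have x_pow: "cg 4 (x k ^ a) (1 + of_nat a * (x k - 1) + ?C 2 * (x k - 1) ^ 2 + ?C 3 * (x k - 1) ^ 3)"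
    if "k < p" for k
  proof -
    obtain u where "u \<in> pint" "x k = 1 + ?P * u" using x_eq_one_plus[OF \<open>k < p\<close>] by blast
    with power_expansion[of u a] show ?thesis by simp
  qed
  have Q_pow: "cg 4 (Q ^ a) (1 + of_nat a * (Q - 1) + ?C 2 * (Q - 1) ^ 2 + ?C 3 * (Q - 1) ^ 3)"
  proof -
    obtain u where "u \<in> pint" "Q = 1 + ?P * u"
      using cgE[OF Q_cong] by (metis power_one_right)
    with power_expansion[of u a] show ?thesis by simp
  qed
  have "cg 4 (\<Sum>k\<le>p-1. (-1) ^ k * x k ^ a)
    (\<Sum>k\<le>p-1. (-1) ^ k * (1 + of_nat a * (x k - 1) + ?C 2 * (x k - 1) ^ 2 + ?C 3 * (x k - 1) ^ 3))"
    using p_ge_5 pint_of_int[of "(-1) ^ _"] by (intro cg_sum cg_cmult x_pow) auto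
  also have "\<dots> = T 0 + of_nat a * T 1 + ?C 2 * T 2 + ?C 3 * T 3"
    unfolding T_def sum_distrib_left sum.distrib[symmetric]
    by (intro sum.cong refl) (simp add: algebra_simps)
  also have "cg 4 \<dots> (T 0 + of_nat a * T 1 + ?C 2 * ((Q - 1) ^ 2 - ?P ^ 3 * (cubes / 24)) +
      ?C 3 * ((Q - 1) ^ 3 - ?P ^ 3 * (3 / 16 * cubes)))"
    by (intro cg_add cg_refl cg_cmult T_2_cong T_3_cong pint_of_nat)
  \<comment> \<open>The deviations \<open>1/24\<close> and \<open>3/16\<close> are put over 48,
    written as \<open>2^4 * 3^1\<close> so that \<open>not_dvd_2_3_power\<close> applies.\<close>
  also have "\<dots> = (1 + of_nat a * (Q - 1) + ?C 2 * (Q - 1) ^ 2 + ?C 3 * (Q - 1) ^ 3) -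
      ?P ^ 3 * ((2 * ?C 2 + 9 * ?C 3) / of_nat (2 ^ 4 * 3 ^ 1) * cubes)"
    unfolding T_0 T_1 by (simp add: field_simps)
  also have "cg 4 \<dots> (Q ^ a - ?P ^ 3 * ((2 * ?C 2 + 9 * ?C 3) / of_nat (2 ^ 4 * 3 ^ 1) * (- 2 * bernoulli (p - 3))))"
  proof (rule cg_diff[OF cg_sym[OF Q_pow]])
    have "(2 * ?C 2 + 9 * ?C 3) / of_nat (2 ^ 4 * 3 ^ 1) \<in> pint"
      by (intro pint_divide_of_nat pint_add pint_mult pint_numeral pint_of_nat not_dvd_2_3_power)
    from cg_p_power_mult[OF cg_cmult[OF cubes_cong_bernoulli this], of 3]
    show "cg 4 (?P ^ 3 * ((2 * ?C 2 + 9 * ?C 3) / of_nat (2 ^ 4 * 3 ^ 1) * cubes))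
       (?P ^ 3 * ((2 * ?C 2 + 9 * ?C 3) / of_nat (2 ^ 4 * 3 ^ 1) * (- 2 * bernoulli (p - 3))))"
      by simp
  qed
  also have "\<dots> = Q ^ a + of_nat a * (of_nat a - 1) * (3 * of_nat a - 4) / 48 * ?P ^ 3 * bernoulli (p - 3)"
  proof -
    have "(2 * ?C 2 + 9 * ?C 3) / of_nat (2 ^ 4 * 3 ^ 1) * 2 =
      of_nat a * (of_nat a - 1) * (3 * of_nat a - 4) / 48"
      unfolding of_nat_choose_2 of_nat_choose_3 by (simp add: field_simps)
    moreover have "q - N * (e * (- 2 * b)) = q + (e * 2) * N * b" for q N e b :: rat
      by simp
    ultimately show ?thesis by metis
  qed
  finally show ?thesis .
qed

end

text \<open>For \<open>p = 3\<close> the signed binomials are 1, -2, 1, and the sum is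
  \<open>2 - (-2)^a\<close>. Both \<open>-2 = 1 - 3\<close> and \<open>4 = 1 + 3\<close> are
  expanded; since 3 divides 48, the rational term is kept exact. Its factor 27 is \<open>p^3\<close>
  times the Bernoulli number of index 0.\<close>

lemma sum_choose_power_mod_81:
  assumes "a > 0"
  shows "rat_cong_pow (\<Sum>k\<le>2. (-1) ^ k * ((-1) ^ k * of_nat (2 choose k)) ^ a)
    (4 ^ a + of_nat a * (of_nat a - 1) * (3 * of_nat a - 4) / 48 * 27) 3 4"
proof -
  interpret prime_modulus 3 by unfold_locales simp
  let ?C = "\<lambda>i. of_nat (a choose i) :: rat"
  have "(\<Sum>k\<le>2. (-1) ^ k * ((-1) ^ k * of_nat (2 choose k)) ^ a) = 2 - (-2 :: rat) ^ a"
    by (simp add: numeral_2_eq_2)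
  also have "cg 4 \<dots> (2 - (1 - 3 * of_nat a + 9 * ?C 2 - 27 * ?C 3))"
    using power_expansion[of "- 1" a] pint_uminus[OF pint_numeral(2)]
    by (intro cg_diff cg_refl) (simp add: mult.commute)
  also have "cg 4 \<dots> ((1 + 3 * of_nat a + 9 * ?C 2 + 27 * ?C 3) +
       of_nat a * (of_nat a - 1) * (3 * of_nat a - 4) / 48 * 27)"
  proof (rule cgI)
    \<comment> \<open>The two sides differ by exactly 81 times this value, as
      \<open>27 / 48 * a * (a - 1) * (3 * a - 4)\<close> is
      \<open>9 / 8 * (2 * ?C 2 + 9 * ?C 3)\<close>.\<close>
    show "- ((?C 3 + 2 * ?C 2) / of_nat 8) \<in> pint"
      by (intro pint_uminus pint_divide_of_nat pint_add pint_mult pint_of_nat pint_numeral) simp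
  qed (simp add: of_nat_choose_2 of_nat_choose_3 field_simps)
  also have "cg 4 \<dots> (4 ^ a + of_nat a * (of_nat a - 1) * (3 * of_nat a - 4) / 48 * 27)"
    using cg_sym[OF power_expansion[of 1 a]] by (intro cg_add cg_refl) (simp add: mult.commute)
  finally show ?thesis by (simp add: cg_def)
qed

theorem theorem1p1:
  fixes p a :: nat
  assumes "prime p" and "odd p" and "a > 0"
  shows "rat_cong_pow
    (\<Sum>k=0..p-1. (-1) ^ ((a - 1) * k) * (of_nat ((p - 1) choose k)) ^ a)
    (2 ^ (a * (p - 1)) + of_nat a * (of_nat a - 1) * (3 * of_nat a - 4) / 48
        * (of_nat p) ^ 3 * bernoulli (p - 3))
    (int p) 4"
proof -
  have "(\<Sum>k=0..p-1. (-1) ^ ((a - 1) * k) * of_nat ((p - 1) choose k) ^ a) =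
        (\<Sum>k\<le>p-1. (-1) ^ k * ((-1) ^ k * of_nat ((p - 1) choose k)) ^ a :: rat)"
  proof (intro sum.cong)
    fix k
    \<comment> \<open>With \<open>a = b + 1\<close> the exponents \<open>b * k\<close> and
      \<open>k + a * k\<close> differ by \<open>2 * k\<close>, so the signs agree.\<close>
    obtain b where "a = Suc b" using \<open>a > 0\<close> gr0_implies_Suc by blast
    then show "(-1) ^ ((a - 1) * k) * of_nat ((p - 1) choose k) ^ a =
        (-1) ^ k * ((-1) ^ k * of_nat ((p - 1) choose k) :: rat) ^ a"
      by (cases "even k"; cases "even b") (simp_all add: power_mult_distrib)
  qed auto
  moreover have "p \<noteq> 4" "p \<ge> 2" "p \<noteq> 2" using assms prime_ge_2_nat by auto
  then have "p = 3 \<or> p \<ge> 5" by linarith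
  then have "rat_cong_pow (\<Sum>k\<le>p-1. (-1) ^ k * ((-1) ^ k * of_nat ((p - 1) choose k)) ^ a)
    (2 ^ (a * (p - 1)) + of_nat a * (of_nat a - 1) * (3 * of_nat a - 4) / 48
        * (of_nat p) ^ 3 * bernoulli (p - 3)) (int p) 4"
  proof
    assume "p = 3"
    moreover have "2 ^ (a * 2) = (4 ^ a :: rat)" by (simp add: power_mult mult.commute[of a])
    ultimately show ?thesis using sum_choose_power_mod_81[OF \<open>a > 0\<close>] by (simp add: bernoulli_0)
  next
    assume "p \<ge> 5"
    moreover obtain m where "p = 2 * m + 1" using \<open>odd p\<close> oddE by blast
    ultimately interpret prime_ge_5 p m using \<open>prime p\<close> by unfold_locales
    show ?thesis using sum_x_power[of a]
      by (simp add: cg_def x_def Q_def mult.commute[of a] flip: power_mult)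
  qed
  ultimately show ?thesis by simp
qed

end
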